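(* Let $\mathcal{A}'$ be an arbitrary arrangement of $d'\ge 3$ lines in the complex projective plane $\mathbb{P}^2$ which is not a pencil. Then for a generic point $p\in\mathbb{P}^2$ (i.e. for every $p$ in some nonempty Zariski open subset of $\mathbb{P}^2$, disjoint from the lines of $\mathcal{A}'$) and every integer $e\ge 0$, any cone $\mathcal{A}=C(\mathcal{A}')_e$ over $\mathcal{A}'$ with vertex $p$, which is a supersolvable line arrangement, satisfies $n_2\ge\frac{d}{2}$, where $d=|\mathcal{A}|$ and $n_2$ is the number of double points of $\mathcal{A}$.
   Context: A line arrangement in $\mathbb{P}^2$ is a finite set of distinct lines; it is a pencil if all its lines pass through one common point. An intersection point is a point lying on at least two lines of the arrangement; its multiplicity is the number of lines through it, and a double point is an intersection point of multiplicity exactly $2$. An arrangement is supersolvable if it has a modular point, that is, an intersection point $p$ such that for every other intersection point $q$ the line $\overline{pq}$ belongs to the arrangement. Cones: let $\mathcal{A}'$ be a line arrangement and $p\in\mathbb{P}^2$ a point not situated on any line of $\mathcal{A}'$ (the vertex). The arrangement $C(\mathcal{A}')_0=C(\mathcal{A}',p)_0$ is obtained by adding to the lines of $\mathcal{A}'$ all the lines joining $p$ to the intersection points of $\mathcal{A}'$. For $e\ge 0$, a cone $C(\mathcal{A}')_e=C(\mathcal{A}',p)_e$ is obtained from $C(\mathcal{A}')_0$ by adding $e$ new distinct lines through $p$ which meet $\mathcal{A}'$ only at simple points (i.e. contain no intersection point of $\mathcal{A}'$). *)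

theory Defs
  imports "HOL-Analysis.Analysis"
begin

text \<open>Points of the complex projective plane are the one-dimensional complex subspaces of
  \<^typ>\<open>complex ^ 3\<close>; lines are the point sets cut out by two-dimensional complex subspaces.
  The constants \<open>vec.subspace\<close>, \<open>vec.span\<close>, \<open>vec.dim\<close> are taken over the scalar field
  \<^typ>\<open>complex\<close>, unlike their unqualified (real) versions.\<close>

typedef cp2 = "{V :: (complex ^ 3) set. vec.subspace V \<and> vec.dim V = 1}"
  morphisms subspace_of point_of
proof -
  obtain V :: "(complex ^ 3) set" where "vec.subspace V" "vec.dim V = 1"
    using vec.choose_subspace_of_subspace[of 1 "UNIV :: (complex ^ 3) set"]
    by (auto simp: vec_dim_card card_cart_basis)
  then show ?thesis by blast
qed

definition proj_lines :: "cp2 set set" where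
  "proj_lines = {{p. subspace_of p \<subseteq> W} | W. vec.subspace W \<and> vec.dim W = 2}"

text \<open>The line through two points; only meaningful when they are distinct.\<close>

definition join_line :: "cp2 \<Rightarrow> cp2 \<Rightarrow> cp2 set" where
  "join_line p q = {r. subspace_of r \<subseteq> vec.span (subspace_of p \<union> subspace_of q)}"

definition homogeneous_form :: "nat \<Rightarrow> (complex ^ 3 \<Rightarrow> complex) \<Rightarrow> bool" where
  "homogeneous_form n F \<longleftrightarrow>
     (\<exists>c :: nat \<Rightarrow> nat \<Rightarrow> complex. \<forall>v.
        F v = (\<Sum>i\<le>n. \<Sum>j\<le>n - i. c i j * (v $ 1) ^ i * (v $ 2) ^ j * (v $ 3) ^ (n - i - j)))"

definition zariski_closed :: "cp2 set \<Rightarrow> bool" where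
  "zariski_closed Z \<longleftrightarrow>
     (\<exists>S. (\<forall>F\<in>S. \<exists>n. homogeneous_form n F) \<and>
          Z = {p. \<forall>F\<in>S. \<forall>v\<in>subspace_of p - {0}. F v = 0})"

definition zariski_open :: "cp2 set \<Rightarrow> bool" where
  "zariski_open U \<longleftrightarrow> zariski_closed (- U)"

definition line_arrangement :: "cp2 set set \<Rightarrow> bool" where
  "line_arrangement A \<longleftrightarrow> finite A \<and> A \<subseteq> proj_lines"

definition is_pencil :: "cp2 set set \<Rightarrow> bool" where
  "is_pencil A \<longleftrightarrow> (\<exists>p. \<forall>L\<in>A. p \<in> L)"

definition point_mult :: "cp2 set set \<Rightarrow> cp2 \<Rightarrow> nat" where
  "point_mult A p = card {L \<in> A. p \<in> L}"

definition intersection_points :: "cp2 set set \<Rightarrow> cp2 set" where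
  "intersection_points A = {p. point_mult A p \<ge> 2}"

definition double_points :: "cp2 set set \<Rightarrow> cp2 set" where
  "double_points A = {p \<in> intersection_points A. point_mult A p = 2}"

definition modular_point :: "cp2 set set \<Rightarrow> cp2 \<Rightarrow> bool" where
  "modular_point A p \<longleftrightarrow>
     p \<in> intersection_points A \<and>
     (\<forall>q \<in> intersection_points A. q \<noteq> p \<longrightarrow> join_line p q \<in> A)"

definition supersolvable :: "cp2 set set \<Rightarrow> bool" where
  "supersolvable A \<longleftrightarrow> (\<exists>p. modular_point A p)"

definition cone0 :: "cp2 set set \<Rightarrow> cp2 \<Rightarrow> cp2 set set" where
  "cone0 A' p = A' \<union> join_line p ` intersection_points A'"

text \<open>\<open>is_cone A' p e A\<close>: the arrangement \<open>A\<close> is one of the cones over \<open>A'\<close> with vertex \<open>p\<close>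
  and \<open>e\<close> additional lines, which form the set \<open>N\<close>.\<close>

definition is_cone :: "cp2 set set \<Rightarrow> cp2 \<Rightarrow> nat \<Rightarrow> cp2 set set \<Rightarrow> bool" where
  "is_cone A' p e A \<longleftrightarrow>
     p \<notin> \<Union>A' \<and>
     (\<exists>N. finite N \<and> card N = e \<and> N \<subseteq> proj_lines \<and> N \<inter> cone0 A' p = {} \<and>
          (\<forall>L\<in>N. p \<in> L \<and> L \<inter> intersection_points A' = {}) \<and>
          A = cone0 A' p \<union> N)"

end

theory Submission
  imports Defs
begin

text \<open>Let \<open>I\<close> be the set of intersection points of \<open>A'\<close> and let \<open>p\<close> avoid the lines of \<open>A'\<close> and all
  lines joining two points of \<open>I\<close>. Every line of a cone \<open>A\<close> with vertex \<open>p\<close> contains a double point: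
  since \<open>A'\<close> is not a pencil, every line of \<open>A'\<close> misses some point of \<open>I\<close> and every line of \<open>A\<close>
  through \<open>p\<close> meets some line of \<open>A'\<close> outside \<open>I\<close>; and where a line through \<open>p\<close> meets a line of \<open>A'\<close>
  outside \<open>I\<close> no third line of \<open>A\<close> passes. As each double point lies on two lines only,
  \<open>d \<le> 2 n\<^sub>2\<close>.\<close>

section \<open>Incidence in the projective plane\<close>

lemma subspace_subspace_of [simp]: "vec.subspace (subspace_of p)"
  and dim_subspace_of [simp]: "vec.dim (subspace_of p) = 1"
  using subspace_of[of p] by auto

lemma span_singleton_point:
  fixes v :: "complex ^ 3"
  assumes "v \<noteq> 0"
  obtains p where "subspace_of p = vec.span {v}"
proof
  show "subspace_of (point_of (vec.span {v})) = vec.span {v}"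
    using assms by (intro point_of_inverse) simp
qed

text \<open>Distinct one-dimensional subspaces meet only in 0, so the dimension formula for sums
  gives 1 + 1.\<close>

lemma dim_span_two_points:
  assumes "p \<noteq> q"
  shows "vec.dim (vec.span (subspace_of p \<union> subspace_of q)) = 2"
proof -
  let ?P = "subspace_of p" and ?Q = "subspace_of q"
  have "vec.dim (?P \<inter> ?Q) = 0"
  proof (rule ccontr)
    assume "vec.dim (?P \<inter> ?Q) \<noteq> 0"
    then have "?P \<inter> ?Q = ?P" "?P \<inter> ?Q = ?Q"
      by (intro vec.subspace_dim_equal vec.subspace_inter; simp del: vec.dim_eq_0)+
    then show False
      using assms subspace_of_inject[of p q] by simp
  qed
  moreover have "vec.span (?P \<union> ?Q) = {x + y |x y. x \<in> ?P \<and> y \<in> ?Q}"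
    by (simp add: vec.span_Un vec.span_eq_iff[THEN iffD2])
  ultimately show ?thesis
    using vec.dim_sums_Int[of ?P ?Q] by (simp del: vec.dim_eq_0)
qed

lemma join_line_in_proj_lines:
  assumes "p \<noteq> q"
  shows "join_line p q \<in> proj_lines"
  unfolding join_line_def proj_lines_def
  using dim_span_two_points[OF assms] vec.subspace_span by blast

lemma join_line_contains: "p \<in> join_line p q" "q \<in> join_line p q"
  unfolding join_line_def by (auto intro: vec.span_base)

text \<open>The line comes from a two-dimensional subspace containing the two-dimensional span of
  both points, so the two subspaces coincide.\<close>

lemma join_line_eqI:
  assumes "L \<in> proj_lines" "p \<noteq> q" "p \<in> L" "q \<in> L"
  shows "join_line p q = L"
proof -
  obtain W where W: "L = {r. subspace_of r \<subseteq> W}" "vec.subspace W" "vec.dim W = 2"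
    using assms(1) unfolding proj_lines_def by blast
  have "vec.span (subspace_of p \<union> subspace_of q) \<subseteq> W"
    using assms(3,4) W by (intro vec.span_minimal) auto
  then have "vec.span (subspace_of p \<union> subspace_of q) = W"
    using W dim_span_two_points[OF assms(2)] by (intro vec.subspace_dim_equal) auto
  then show ?thesis
    by (simp add: join_line_def W(1))
qed

lemma proj_line_unique:
  assumes "L \<in> proj_lines" "M \<in> proj_lines" "p \<noteq> q" "p \<in> L" "q \<in> L" "p \<in> M" "q \<in> M"
  shows "L = M"
  using assms join_line_eqI by metis

text \<open>Two planes in a three-dimensional space share a nonzero vector because 2 + 2 > 3; its
  span is the common point.\<close>

lemma proj_lines_meet:
  assumes "L \<in> proj_lines" "M \<in> proj_lines"
  obtains p where "p \<in> L" "p \<in> M"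
proof -
  obtain V where V: "L = {r. subspace_of r \<subseteq> V}" "vec.subspace V" "vec.dim V = 2"
    using assms(1) unfolding proj_lines_def by blast
  obtain W where W: "M = {r. subspace_of r \<subseteq> W}" "vec.subspace W" "vec.dim W = 2"
    using assms(2) unfolding proj_lines_def by blast
  have "vec.dim {x + y |x y. x \<in> V \<and> y \<in> W} \<le> 3"
    using dim_subset_UNIV_cart_gen[of "{x + y |x y. x \<in> V \<and> y \<in> W}"] by simp
  then have "vec.dim (V \<inter> W) \<noteq> 0"
    using vec.dim_sums_Int[of V W] V W by linarith
  then obtain v where v: "v \<in> V" "v \<in> W" "v \<noteq> 0"
    by auto
  obtain p where "subspace_of p = vec.span {v}"
    using span_singleton_point[OF v(3)] .
  then have "subspace_of p \<subseteq> V" "subspace_of p \<subseteq> W"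
    using v V(2) W(2) by (simp_all add: vec.span_minimal)
  then show ?thesis
    using that V(1) W(1) by blast
qed

text \<open>Supplies an equation of the line: a linear map that kills a basis of \<open>W\<close>
  but not a vector outside \<open>W\<close>, read off in its first coordinate.\<close>

lemma proj_line_linear_form:
  assumes "L \<in> proj_lines"
  obtains a :: "complex ^ 3" where "a \<noteq> 0"
    "\<And>p v. p \<in> L \<Longrightarrow> v \<in> subspace_of p \<Longrightarrow> (\<Sum>i\<in>UNIV. a $ i * v $ i) = 0"
proof -
  obtain W where W: "L = {r. subspace_of r \<subseteq> W}" "vec.subspace W" "vec.dim W = 2"
    using assms unfolding proj_lines_def by blast
  obtain B where B: "vec.independent B" "vec.span B = W"
    using vec.basis_subspace_exists[OF W(2)] by metis
  have "W \<noteq> UNIV"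
    using W(3) vec_dim_card[where 'a = complex and 'n = 3] by auto
  then obtain u where u: "u \<notin> W"
    by blast
  then have "vec.independent (insert u B)"
    using B by (simp add: vec.independent_insert)
  then obtain f :: "complex ^ 3 \<Rightarrow> complex ^ 3" where f: "Vector_Spaces.linear (*s) (*s) f"
      "\<forall>x\<in>insert u B. f x = (if x = u then axis 1 1 else 0)"
    using vec.linear_independent_extend[of "insert u B" "\<lambda>x. if x = u then axis 1 1 else 0"]
    by blast
  define a where "a = matrix f $ 1"
  have a: "(\<Sum>i\<in>UNIV. a $ i * v $ i) = f v $ 1" for v
    using matrix_works[OF f(1), of v] by (simp add: a_def matrix_vector_mult_def vec_eq_iff)
  have "u \<notin> B"
    using u B vec.span_base by blast
  then have "\<forall>x\<in>B. f x = 0"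
    using f(2) by auto
  then have "f v = 0" if "v \<in> W" for v
    using that B(2) vec.linear_eq_0_on_span[OF f(1)] by blast
  moreover have "a \<noteq> 0"
    using a[of u] f(2) by auto
  ultimately show ?thesis
    using that[of a] a W(1) by (auto simp: subset_iff)
qed

section \<open>Finitely many lines are avoided on a nonempty Zariski open set\<close>

lemma homogeneous_form_zero: "homogeneous_form n (\<lambda>v. 0)"
  unfolding homogeneous_form_def by (rule exI[of _ "\<lambda>i j. 0"]) simp

lemma homogeneous_form_add:
  assumes "homogeneous_form n F" "homogeneous_form n G"
  shows "homogeneous_form n (\<lambda>v. F v + G v)"
proof -
  obtain c d where
    "\<forall>v. F v = (\<Sum>i\<le>n. \<Sum>j\<le>n - i. c i j * (v $ 1) ^ i * (v $ 2) ^ j * (v $ 3) ^ (n - i - j))"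
    "\<forall>v. G v = (\<Sum>i\<le>n. \<Sum>j\<le>n - i. d i j * (v $ 1) ^ i * (v $ 2) ^ j * (v $ 3) ^ (n - i - j))"
    using assms unfolding homogeneous_form_def by blast
  then show ?thesis
    unfolding homogeneous_form_def
    by (intro exI[of _ "\<lambda>i j. c i j + d i j"]) (simp add: sum.distrib algebra_simps)
qed

lemma homogeneous_form_sum:
  assumes "\<And>x. x \<in> S \<Longrightarrow> homogeneous_form n (F x)"
  shows "homogeneous_form n (\<lambda>v. \<Sum>x\<in>S. F x v)"
  using assms
  by (induction S rule: infinite_finite_induct)
    (simp_all add: homogeneous_form_zero homogeneous_form_add)

lemma homogeneous_form_monomial:
  assumes "i + j + k = n"
  shows "homogeneous_form n (\<lambda>v. a * (v $ 1) ^ i * (v $ 2) ^ j * (v $ 3) ^ k)"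
proof -
  have "a * (v $ 1) ^ i * (v $ 2) ^ j * (v $ 3) ^ k =
      (\<Sum>i'\<le>n. \<Sum>j'\<le>n - i'. (if i' = i \<and> j' = j then a else 0) *
        (v $ 1) ^ i' * (v $ 2) ^ j' * (v $ 3) ^ (n - i' - j'))" (is "?m = ?s")
    for v :: "complex ^ 3"
  proof -
    \<comment> \<open>Nesting the two conditions lets the outer and the inner sum collapse one after
      the other.\<close>
    have "?s = (\<Sum>i'\<le>n. if i' = i then \<Sum>j'\<le>n - i. if j' = j then ?m else 0 else 0)"
    proof (intro sum.cong refl)
      fix i'
      have "(\<Sum>j'\<le>n - i. (if j' = j then a else 0) * (v $ 1) ^ i * (v $ 2) ^ j' *
          (v $ 3) ^ (n - i - j')) = (\<Sum>j'\<le>n - i. if j' = j then ?m else 0)"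
        using assms by (intro sum.cong) auto
      then show "(\<Sum>j'\<le>n - i'. (if i' = i \<and> j' = j then a else 0) * (v $ 1) ^ i' *
          (v $ 2) ^ j' * (v $ 3) ^ (n - i' - j')) =
          (if i' = i then \<Sum>j'\<le>n - i. if j' = j then ?m else 0 else 0)"
        by (cases "i' = i") simp_all
    qed
    also have "\<dots> = ?m"
      using assms by simp
    finally show ?thesis ..
  qed
  then show ?thesis
    unfolding homogeneous_form_def
    by (intro exI[of _ "\<lambda>i' j'. if i' = i \<and> j' = j then a else 0"]) blast
qed

text \<open>Each term of the linear form raises one exponent by 1, so every monomial of
  \<open>F\<close> yields three monomials of degree \<open>Suc n\<close>.\<close>

lemma homogeneous_form_mult_linear:
  assumes "homogeneous_form n F"
  shows "homogeneous_form (Suc n) (\<lambda>v. (\<Sum>i\<in>UNIV. a $ i * v $ i) * F v)"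
proof -
  obtain c where c:
    "\<And>v. F v = (\<Sum>i\<le>n. \<Sum>j\<le>n - i. c i j * (v $ 1) ^ i * (v $ 2) ^ j * (v $ 3) ^ (n - i - j))"
    using assms unfolding homogeneous_form_def by blast
  have "(\<Sum>i\<in>UNIV. a $ i * v $ i) * F v =
      (\<Sum>i\<le>n. \<Sum>j\<le>n - i.
        (a $ 1 * c i j) * (v $ 1) ^ Suc i * (v $ 2) ^ j * (v $ 3) ^ (n - i - j) +
        (a $ 2 * c i j) * (v $ 1) ^ i * (v $ 2) ^ Suc j * (v $ 3) ^ (n - i - j) +
        (a $ 3 * c i j) * (v $ 1) ^ i * (v $ 2) ^ j * (v $ 3) ^ Suc (n - i - j))" for v
    unfolding c sum_distrib_left by (intro sum.cong refl) (simp add: sum_3 algebra_simps)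
  then show ?thesis
    by (simp only:)
      (intro homogeneous_form_sum homogeneous_form_add homogeneous_form_monomial; simp)
qed

lemma homogeneous_form_prod_linear:
  assumes "finite K"
  shows "homogeneous_form (card K) (\<lambda>v. \<Prod>L\<in>K. \<Sum>i\<in>UNIV. a L $ i * v $ i)"
  using assms
proof (induction K rule: finite_induct)
  case empty
  then show ?case
    using homogeneous_form_monomial[of 0 0 0 0 1] by simp
next
  case (insert L K)
  then show ?case
    using homogeneous_form_mult_linear[of "card K" _ "a L"] by simp
qed

text \<open>On the conic of points \<open>(1 : t : t^2)\<close> a linear form becomes a polynomial
  in \<open>t\<close> with the coordinates of \<open>a\<close> as coefficients, and a nonzero
  polynomial has finitely many roots.\<close>

lemma finite_linear_form_zeros_on_conic:
  fixes a :: "complex ^ 3"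
  assumes "a \<noteq> 0"
  shows "finite {t. a $ 1 + a $ 2 * t + a $ 3 * t ^ 2 = 0}"
proof -
  define c where "c i = (if i = 0 then a $ 1 else if i = 1 then a $ 2 else a $ 3)" for i :: nat
  have "c 0 \<noteq> 0 \<or> c 1 \<noteq> 0 \<or> c 2 \<noteq> 0"
    using assms by (auto simp: c_def vec_eq_iff forall_3)
  then have "finite {t. (\<Sum>i\<le>2. c i * t ^ i) = 0}"
    unfolding polyfun_finite_roots by (metis one_le_numeral order_refl zero_le)
  then show ?thesis
    by (simp add: c_def numeral_2_eq_2)
qed

text \<open>\<open>U\<close> is the complement of the zero set of the product of equations of the
  lines. It is nonempty because finitely many lines cannot cover the conic, whose parameter
  \<open>t\<close> ranges over an infinite field.\<close>

lemma zariski_open_avoiding_lines: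
  assumes "finite K" "K \<subseteq> proj_lines"
  obtains U where "zariski_open U" "U \<noteq> {}" "U \<inter> \<Union>K = {}"
proof -
  have "\<forall>L\<in>K. \<exists>a :: complex ^ 3. a \<noteq> 0 \<and>
      (\<forall>p v. p \<in> L \<longrightarrow> v \<in> subspace_of p \<longrightarrow> (\<Sum>i\<in>UNIV. a $ i * v $ i) = 0)"
    using assms(2) proj_line_linear_form by (metis subsetD)
  then obtain a :: "cp2 set \<Rightarrow> complex ^ 3" where a: "\<And>L. L \<in> K \<Longrightarrow> a L \<noteq> 0"
      "\<And>L p v. L \<in> K \<Longrightarrow> p \<in> L \<Longrightarrow> v \<in> subspace_of p \<Longrightarrow> (\<Sum>i\<in>UNIV. a L $ i * v $ i) = 0"
    by metis
  define F where "F v = (\<Prod>L\<in>K. \<Sum>i\<in>UNIV. a L $ i * v $ i)" for v :: "complex ^ 3"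
  define Z where "Z = {p. \<forall>v\<in>subspace_of p - {0}. F v = 0}"
  have "homogeneous_form (card K) F"
    unfolding F_def by (rule homogeneous_form_prod_linear[OF assms(1)])
  then have "zariski_closed Z"
    unfolding zariski_closed_def Z_def by (intro exI[of _ "{F}"]) auto
  moreover have "\<Union>K \<subseteq> Z"
    using a(2) assms(1) unfolding Z_def F_def by (fastforce simp: prod_zero_iff)
  moreover have "Z \<noteq> UNIV"
  proof -
    have "finite (\<Union>L\<in>K. {t. a L $ 1 + a L $ 2 * t + a L $ 3 * t ^ 2 = 0})"
      using assms(1) a(1) finite_linear_form_zeros_on_conic by blast
    then obtain t where t: "t \<notin> (\<Union>L\<in>K. {t. a L $ 1 + a L $ 2 * t + a L $ 3 * t ^ 2 = 0})"
      using ex_new_if_finite[OF infinite_UNIV_char_0] by blast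
    define v :: "complex ^ 3" where "v = vector [1, t, t ^ 2]"
    have "F v \<noteq> 0"
      using t assms(1) by (auto simp: F_def v_def sum_3)
    moreover have "v \<noteq> 0"
      by (auto simp: v_def vec_eq_iff forall_3)
    moreover obtain p where "subspace_of p = vec.span {v}"
      using span_singleton_point[OF \<open>v \<noteq> 0\<close>] .
    ultimately have "p \<notin> Z"
      unfolding Z_def using vec.span_base by blast
    then show ?thesis
      by blast
  qed
  ultimately show ?thesis
    using that[of "- Z"] unfolding zariski_open_def by auto
qed

section \<open>Intersection points of arrangements\<close>

text \<open>Finiteness makes the multiplicity a true count, since \<open>card\<close> of an infinite
  set is 0.\<close>

lemma mem_intersection_points_iff:
  assumes "finite A"
  shows "x \<in> intersection_points A \<longleftrightarrow> (\<exists>L\<in>A. \<exists>M\<in>A. L \<noteq> M \<and> x \<in> L \<and> x \<in> M)"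
proof -
  have "x \<in> intersection_points A \<longleftrightarrow> \<not> card {L \<in> A. x \<in> L} \<le> Suc 0"
    by (auto simp: intersection_points_def point_mult_def)
  also have "\<dots> \<longleftrightarrow> (\<exists>L\<in>A. \<exists>M\<in>A. L \<noteq> M \<and> x \<in> L \<and> x \<in> M)"
    using assms by (subst card_le_Suc0_iff_eq) auto
  finally show ?thesis .
qed

text \<open>There are finitely many pairs of distinct lines, and each pair shares at most one
  point.\<close>

lemma finite_intersection_points:
  assumes "line_arrangement A"
  shows "finite (intersection_points A)"
proof -
  have fin: "finite A" and lines: "A \<subseteq> proj_lines"
    using assms by (auto simp: line_arrangement_def)
  have "finite (L \<inter> M)" if "L \<in> A" "M \<in> A" "L \<noteq> M" for L M
  proof (cases "L \<inter> M = {}")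
    case False
    then obtain x where "x \<in> L \<inter> M"
      by blast
    then have "L \<inter> M \<subseteq> {x}"
      using that lines proj_line_unique[of L M] by blast
    then show ?thesis
      by (rule finite_subset) simp
  qed simp
  then have "finite (\<Union>L\<in>A. \<Union>M\<in>A - {L}. L \<inter> M)"
    using fin by (intro finite_UN_I) auto
  moreover have "intersection_points A \<subseteq> (\<Union>L\<in>A. \<Union>M\<in>A - {L}. L \<inter> M)"
    using mem_intersection_points_iff[OF fin] by blast
  ultimately show ?thesis
    by (rule finite_subset[rotated])
qed

text \<open>Let \<open>M\<close> be another line, meeting \<open>L\<close> in \<open>x\<close>, and
  \<open>K\<close> a line missing \<open>x\<close>. Then \<open>K\<close> and \<open>M\<close> meet
  in some \<open>q\<close> different from \<open>x\<close>, and \<open>q\<close> is off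
  \<open>L\<close> because \<open>L\<close> and \<open>M\<close> share only
  \<open>x\<close>.\<close>

lemma intersection_point_off_line:
  assumes "line_arrangement A" "card A \<ge> 3" "\<not> is_pencil A" "L \<in> A"
  obtains q where "q \<in> intersection_points A" "q \<notin> L"
proof -
  have fin: "finite A" and lines: "A \<subseteq> proj_lines"
    using assms(1) by (auto simp: line_arrangement_def)
  have "card (A - {L}) \<ge> 2"
    using assms(2,4) fin by simp
  then obtain M where M: "M \<in> A" "M \<noteq> L"
    by (metis Diff_iff all_not_in_conv card.empty insertI1 not_numeral_le_zero)
  then obtain x where x: "x \<in> L" "x \<in> M"
    using proj_lines_meet assms(4) lines by (metis subsetD)
  obtain K where K: "K \<in> A" "x \<notin> K"
    using assms(3) by (auto simp: is_pencil_def)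
  then obtain q where q: "q \<in> K" "q \<in> M"
    using proj_lines_meet M(1) lines by (metis subsetD)
  have "q \<in> intersection_points A"
    using mem_intersection_points_iff[OF fin] K M(1) q x by blast
  moreover have "q \<notin> L"
    using proj_line_unique[of L M x q] assms(4) lines M x q K by blast
  ultimately show ?thesis
    using that by blast
qed

section \<open>Double points and the count of lines\<close>

lemma double_pointI:
  assumes "L \<in> A" "M \<in> A" "L \<noteq> M" "x \<in> L" "x \<in> M"
    and "\<And>K. K \<in> A \<Longrightarrow> x \<in> K \<Longrightarrow> K = L \<or> K = M"
  shows "x \<in> double_points A"
proof -
  have "{K \<in> A. x \<in> K} = {L, M}"
    using assms by blast
  then show ?thesis
    using assms(3) by (simp add: double_points_def intersection_points_def point_mult_def)
qed

text \<open>Incidences between lines and double points are counted twice: at least one per line,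
  exactly two per double point.\<close>

lemma card_le_twice_double_points:
  assumes "line_arrangement A" "\<And>L. L \<in> A \<Longrightarrow> \<exists>x\<in>double_points A. x \<in> L"
  shows "card A \<le> 2 * card (double_points A)"
proof -
  have fin: "finite (double_points A)"
    using finite_intersection_points[OF assms(1)] by (simp add: double_points_def)
  have "A \<subseteq> (\<Union>x\<in>double_points A. {L \<in> A. x \<in> L})"
    using assms(2) by blast
  moreover have "finite A"
    using assms(1) by (simp add: line_arrangement_def)
  ultimately have "card A \<le> card (\<Union>x\<in>double_points A. {L \<in> A. x \<in> L})"
    using fin by (intro card_mono) auto
  also have "\<dots> \<le> (\<Sum>x\<in>double_points A. card {L \<in> A. x \<in> L})"
    by (rule card_UN_le[OF fin])
  also have "\<dots> = 2 * card (double_points A)"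
    by (simp add: double_points_def point_mult_def)
  finally show ?thesis .
qed

section \<open>Cones with generic vertex\<close>

text \<open>The assumption \<open>generic\<close> makes the joins of \<open>p\<close> with different
  intersection points of \<open>A'\<close> different lines.\<close>

locale generic_cone =
  fixes A' :: "cp2 set set" and p :: cp2 and N A :: "cp2 set set"
  assumes arr: "line_arrangement A'" and card: "card A' \<ge> 3" and not_pencil: "\<not> is_pencil A'"
    and vertex: "p \<notin> \<Union>A'"
    and generic: "\<And>q r. q \<in> intersection_points A' \<Longrightarrow> r \<in> intersection_points A' \<Longrightarrow>
      q \<noteq> r \<Longrightarrow> p \<notin> join_line q r"
    and finite_N: "finite N" and N_lines: "N \<subseteq> proj_lines"
    and N_through: "\<And>L. L \<in> N \<Longrightarrow> p \<in> L"
    and N_simple: "\<And>L. L \<in> N \<Longrightarrow> L \<inter> intersection_points A' = {}"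
    and A_eq: "A = cone0 A' p \<union> N"
begin

abbreviation "I \<equiv> intersection_points A'"

lemma finite_A': "finite A'" and A'_lines: "A' \<subseteq> proj_lines"
  using arr by (auto simp: line_arrangement_def)

lemma vertex_not_in_I: "p \<notin> I"
  using vertex mem_intersection_points_iff[OF finite_A'] by blast

lemma line_arrangement_cone: "line_arrangement A"
proof -
  have "join_line p ` I \<subseteq> proj_lines"
    using vertex_not_in_I by (metis image_subsetI join_line_in_proj_lines)
  then show ?thesis
    using finite_intersection_points[OF arr] finite_A' A'_lines finite_N N_lines
    by (simp add: line_arrangement_def A_eq cone0_def)
qed

lemma cone_lines: "A \<subseteq> proj_lines" and finite_A: "finite A"
  using line_arrangement_cone by (auto simp: line_arrangement_def)

text \<open>The recorded position of \<open>p\<close> serves to recognise a line of \<open>A\<close>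
  missing \<open>p\<close> as a line of \<open>A'\<close>.\<close>

lemma cone_cases:
  assumes "L \<in> A"
  obtains (base) "L \<in> A'" "p \<notin> L"
    | (join) q where "q \<in> I" "L = join_line p q" "p \<in> L" "q \<in> L"
    | (new) "L \<in> N" "p \<in> L"
proof -
  consider "L \<in> A'" | q where "q \<in> I" "L = join_line p q" | "L \<in> N"
    using assms unfolding A_eq cone0_def by blast
  then show thesis
  proof cases
    case 1
    then show thesis
      using vertex by (intro base) auto
  next
    case (2 q)
    then show thesis
      using join_line_contains by (intro join) auto
  next
    case 3
    then show thesis
      using N_through by (intro new) auto
  qed
qed

lemma base_in_cone: "L \<in> A' \<Longrightarrow> L \<in> A" and join_in_cone: "q \<in> I \<Longrightarrow> join_line p q \<in> A"
  by (auto simp: A_eq cone0_def)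

text \<open>A further line through \<open>x\<close> either contains \<open>p\<close>, and is then
  \<open>M\<close> as the only line through \<open>p\<close> and \<open>x\<close>, or belongs to
  \<open>A'\<close>, and is then \<open>L\<close> because \<open>x\<close> is not in
  \<open>I\<close>.\<close>

lemma double_point_off_I:
  assumes "M \<in> A" "p \<in> M" "L \<in> A'" "x \<in> L" "x \<in> M" "x \<notin> I"
  shows "x \<in> double_points A"
proof (rule double_pointI)
  show "M \<in> A" "L \<in> A" "x \<in> M" "x \<in> L"
    using assms base_in_cone by auto
  have px: "p \<noteq> x"
    using assms(3,4) vertex by blast
  show "M \<noteq> L"
    using assms(2,3) vertex by blast
  fix K assume K: "K \<in> A" "x \<in> K"
  show "K = M \<or> K = L"
  proof (cases "p \<in> K")
    case True
    then show ?thesis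
      using K px assms cone_lines proj_line_unique[of K M p x] by blast
  next
    case False
    with K(1) have "K \<in> A'"
      by (cases rule: cone_cases) auto
    then show ?thesis
      using K(2) assms(3,4,6) mem_intersection_points_iff[OF finite_A'] by blast
  qed
qed

text \<open>This is where genericity enters: a second point \<open>x\<close> of \<open>I\<close> on
  the line would place \<open>p\<close> on the join of \<open>x\<close> and
  \<open>q\<close>.\<close>

lemma I_on_join:
  assumes "q \<in> I" "x \<in> I" "x \<in> join_line p q"
  shows "x = q"
proof (rule ccontr)
  assume "x \<noteq> q"
  moreover have "p \<noteq> q"
    using assms(1) vertex_not_in_I by blast
  ultimately have "join_line x q = join_line p q"
    using assms(3) join_line_in_proj_lines join_line_contains by (intro join_line_eqI) auto
  then show False
    using generic[OF assms(2,1) \<open>x \<noteq> q\<close>] join_line_contains by simp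
qed

text \<open>The lines meet in some \<open>x\<close>. It is not in \<open>I\<close>, since the only
  point of \<open>I\<close> on the join is \<open>q\<close>, which is off \<open>L\<close>.\<close>

lemma double_point_join:
  assumes "q \<in> I" "L \<in> A'" "q \<notin> L"
  obtains x where "x \<in> double_points A" "x \<in> L" "x \<in> join_line p q"
proof -
  have "L \<in> proj_lines" "join_line p q \<in> proj_lines"
    using assms(1,2) A'_lines join_in_cone cone_lines by auto
  then obtain x where x: "x \<in> L" "x \<in> join_line p q"
    by (rule proj_lines_meet)
  have "x \<notin> I"
    using I_on_join[OF assms(1) _ x(2)] x(1) assms(3) by blast
  then have "x \<in> double_points A"
    using double_point_off_I[OF join_in_cone[OF assms(1)]] join_line_contains assms(2) x by blast
  then show ?thesis
    using that x by blast
qed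

lemma double_point_on_line:
  assumes "L \<in> A"
  shows "\<exists>x\<in>double_points A. x \<in> L"
  using assms
proof (cases rule: cone_cases)
  case base
  then obtain q where "q \<in> I" "q \<notin> L"
    using intersection_point_off_line[OF arr card not_pencil] by blast
  then show ?thesis
    using double_point_join base by metis
next
  case (join q)
  obtain M where "M \<in> A'" "q \<notin> M"
    using not_pencil by (auto simp: is_pencil_def)
  then show ?thesis
    using double_point_join join by metis
next
  case new
  \<comment> \<open>The arrangement \<open>A'\<close> is nonempty, as the empty one is vacuously a
    pencil.\<close>
  obtain M where M: "M \<in> A'"
    using not_pencil by (auto simp: is_pencil_def)
  then obtain x where "x \<in> L" "x \<in> M"
    using proj_lines_meet A'_lines N_lines new by (metis subsetD)
  then show ?thesis
    using double_point_off_I[OF assms] new M N_simple by blast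
qed

text \<open>If one of two lines of \<open>A\<close> meeting in \<open>x\<close> contains
  \<open>p\<close>, it is the join of \<open>p\<close> and \<open>x\<close>. Otherwise both belong
  to \<open>A'\<close>, so \<open>x\<close> is in \<open>I\<close> and its join with
  \<open>p\<close> was added to the cone.\<close>

lemma modular_point_vertex: "modular_point A p"
  unfolding modular_point_def
proof (intro conjI ballI impI)
  \<comment> \<open>Two different points \<open>q\<close> and \<open>r\<close> of \<open>I\<close>
    are needed, so that their joins with \<open>p\<close> are two lines through \<open>p\<close>;
    \<open>r\<close> is chosen off a line \<open>M\<close> through \<open>q\<close>.\<close>
  obtain L where "L \<in> A'"
    using not_pencil by (auto simp: is_pencil_def)
  then obtain q where q: "q \<in> I"
    using intersection_point_off_line[OF arr card not_pencil] by metis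
  then obtain M where "M \<in> A'" "q \<in> M"
    using mem_intersection_points_iff[OF finite_A'] by blast
  then obtain r where r: "r \<in> I" "r \<noteq> q"
    using intersection_point_off_line[OF arr card not_pencil] by metis
  have "join_line p q \<noteq> join_line p r"
    using I_on_join[OF q r(1)] r(2) join_line_contains by metis
  then show "p \<in> intersection_points A"
    using q r(1) join_in_cone join_line_contains mem_intersection_points_iff[OF finite_A] by meson
next
  fix x assume x: "x \<in> intersection_points A" "x \<noteq> p"
  then obtain L M where LM: "L \<in> A" "M \<in> A" "L \<noteq> M" "x \<in> L" "x \<in> M"
    using mem_intersection_points_iff[OF finite_A] by blast
  show "join_line p x \<in> A"
  proof (cases "p \<in> L \<or> p \<in> M")
    case True
    then show ?thesis
      using LM x(2) cone_lines join_line_eqI by (metis subsetD)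
  next
    case False
    then have "L \<in> A'" "M \<in> A'"
      using LM(1,2) by (auto elim: cone_cases)
    then show ?thesis
      using LM mem_intersection_points_iff[OF finite_A'] join_in_cone by blast
  qed
qed

end

text \<open>Supersolvability is part of the conclusion, because the vertex is modular in every such
  cone. The set \<open>U\<close> depends on \<open>A'\<close> alone and serves all \<open>e\<close>
  and all choices of added lines.\<close>

theorem proposition1p9:
  fixes A' :: "cp2 set set"
  assumes "line_arrangement A'" and "card A' \<ge> 3" and "\<not> is_pencil A'"
  shows "\<exists>U. zariski_open U \<and> U \<noteq> {} \<and> U \<inter> \<Union>A' = {} \<and>
           (\<forall>p\<in>U. \<forall>e :: nat. \<forall>A. is_cone A' p e A \<longrightarrow>
              line_arrangement A \<and> supersolvable A \<and>
              real (card (double_points A)) \<ge> real (card A) / 2)"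
proof -
  let ?I = "intersection_points A'"
  \<comment> \<open>These are the lines a generic vertex has to avoid besides \<open>A'\<close>. The
    diagonal is removed because \<open>join_line q q\<close> is just the point \<open>q\<close> and
    not a line.\<close>
  define J where "J = (\<lambda>(q, r). join_line q r) ` (?I \<times> ?I - Id)"
  have "finite J"
    unfolding J_def using finite_intersection_points[OF assms(1)] by blast
  moreover have "J \<subseteq> proj_lines"
    unfolding J_def using join_line_in_proj_lines by auto
  moreover have "finite A'" "A' \<subseteq> proj_lines"
    using assms(1) by (auto simp: line_arrangement_def)
  ultimately have "finite (A' \<union> J)" "A' \<union> J \<subseteq> proj_lines"
    by auto
  then obtain U where U: "zariski_open U" "U \<noteq> {}" "U \<inter> \<Union>(A' \<union> J) = {}"
    by (rule zariski_open_avoiding_lines)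
  have "line_arrangement A \<and> supersolvable A \<and> real (card (double_points A)) \<ge> real (card A) / 2"
    if "p \<in> U" and cone: "is_cone A' p e A" for p e A
  proof -
    obtain N where N: "finite N" "N \<subseteq> proj_lines" "\<forall>L\<in>N. p \<in> L \<and> L \<inter> ?I = {}"
        "A = cone0 A' p \<union> N" "p \<notin> \<Union>A'"
      using cone unfolding is_cone_def by blast
    have "p \<notin> join_line q r" if "q \<in> ?I" "r \<in> ?I" "q \<noteq> r" for q r
    proof -
      have "join_line q r \<in> J"
        unfolding J_def using that by force
      then show ?thesis
        using U(3) \<open>p \<in> U\<close> by blast
    qed
    then interpret generic_cone A' p N A
      using assms N by unfold_locales blast+
    show ?thesis
      using line_arrangement_cone modular_point_vertex
        card_le_twice_double_points[OF line_arrangement_cone double_point_on_line]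
      by (auto simp: supersolvable_def)
  qed
  then show ?thesis
    using U by blast
qed

end
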